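(* Let $\hat{\mathbf x}_1,\hat{\mathbf x}_2,\hat{\mathbf x}_3$ be three finite points of $\mathrm P\mathbb R^2$ and $\mathbf l_1,\mathbf l_2$ two lines of $\mathrm P\mathbb R^2$ such that the three points and two lines are in general position. If $\hat{\mathbf x}_i^T\mathbf l_1\neq0$ and $\hat{\mathbf x}_i^T\mathbf l_2\neq0$ for $i=1,2,3$, and the point $\mathbf l_1\times\mathbf l_2$ does not lie on any side of the triangle $\hat{\mathbf x}_1\hat{\mathbf x}_2\hat{\mathbf x}_3$, then the problem of determining a non-degenerate conic $\mathbf C$ (over $\mathbb C$) such that $\hat{\mathbf x}_i^T\mathbf C\hat{\mathbf x}_i=0$ for $i=1,2,3$ and $\mathbf l_j^T\mathbf C^{-1}\mathbf l_j=0$ for $j=1,2$ has four distinct solutions.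
   Context: $\mathrm P\mathbb R^2$ is the real projective plane. A hat denotes a finite point in normalized homogeneous coordinates, i.e. a vector of $\mathbb R^3$ whose third component is $1$. A line is given by a nonzero vector $\mathbf l\in\mathbb R^3$ (up to scale), and $\mathbf x$ lies on $\mathbf l$ iff $\mathbf x^T\mathbf l=0$; the two lines are distinct and the cross product $\mathbf l_1\times\mathbf l_2$ is their intersection point. A side of a triangle is the full line through two of its vertices. Three points and two lines are in general position if the three points are non-collinear, neither $\mathbf l_1$ nor $\mathbf l_2$ is a side of the triangle $\hat{\mathbf x}_1\hat{\mathbf x}_2\hat{\mathbf x}_3$, and the intersection point of $\mathbf l_1$ and $\mathbf l_2$ is not a vertex of that triangle. A conic is a nonzero complex symmetric $3\times3$ matrix up to nonzero scale; it is non-degenerate if its determinant is nonzero. Solutions are counted up to scale. *)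

theory Defs
  imports "HOL-Analysis.Analysis"
begin

text \<open>
  Points and lines of the real projective plane are represented by nonzero vectors of
  \<open>real^3\<close>, up to nonzero scale.
\<close>

definition proj_eq :: "real^3 \<Rightarrow> real^3 \<Rightarrow> bool" where
  "proj_eq u v \<longleftrightarrow> (\<exists>k. k \<noteq> 0 \<and> v = k *\<^sub>R u)"

definition lies_on :: "real^3 \<Rightarrow> real^3 \<Rightarrow> bool" where
  "lies_on x l \<longleftrightarrow> x \<bullet> l = 0"

definition collinear_points :: "(3 \<Rightarrow> real^3) \<Rightarrow> bool" where
  "collinear_points x \<longleftrightarrow> (\<exists>l. l \<noteq> 0 \<and> (\<forall>i. lies_on (x i) l))"

text \<open>For pairwise distinct vertices, the line through two of them is unique up to scale.\<close>

definition is_side :: "(3 \<Rightarrow> real^3) \<Rightarrow> real^3 \<Rightarrow> bool" where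
  "is_side x l \<longleftrightarrow> l \<noteq> 0 \<and> (\<exists>i j. i \<noteq> j \<and> lies_on (x i) l \<and> lies_on (x j) l)"

definition general_position :: "(3 \<Rightarrow> real^3) \<Rightarrow> (2 \<Rightarrow> real^3) \<Rightarrow> bool" where
  "general_position x l \<longleftrightarrow>
     \<not> collinear_points x \<and>
     (\<forall>j. \<not> is_side x (l j)) \<and>
     (\<forall>i. \<not> proj_eq (cross3 (l 1) (l 2)) (x i))"

text \<open>
  The forms below are bilinear, so they use \<open>scalar_product\<close>: on \<open>complex^3\<close> the library's
  inner product is the real-valued one of the underlying real space.
\<close>

definition complex_vec :: "real^'n \<Rightarrow> complex^'n" where
  "complex_vec v = (\<chi> i. complex_of_real (v $ i))"

definition quad_form :: "complex^3^3 \<Rightarrow> real^3 \<Rightarrow> complex" where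
  "quad_form M v = scalar_product (complex_vec v) (M *v complex_vec v)"

definition conic_matrix :: "complex^3^3 \<Rightarrow> bool" where
  "conic_matrix C \<longleftrightarrow> C \<noteq> 0 \<and> transpose C = C"

definition scale_rel :: "(complex^3^3) rel" where
  "scale_rel = {(A, B). \<exists>k. k \<noteq> 0 \<and> B = map_matrix ((*) k) A}"

definition solution_matrices :: "(3 \<Rightarrow> real^3) \<Rightarrow> (2 \<Rightarrow> real^3) \<Rightarrow> (complex^3^3) set" where
  "solution_matrices x l =
     {C. conic_matrix C \<and> det C \<noteq> 0 \<and>
         (\<forall>i. quad_form C (x i) = 0) \<and>
         (\<forall>j. quad_form (matrix_inv C) (l j) = 0)}"

text \<open>
  The solution matrices are closed under nonzero complex scaling, so each class below is a full
  scaling class of matrices, that is, a conic.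
\<close>

definition solution_conics :: "(3 \<Rightarrow> real^3) \<Rightarrow> (2 \<Rightarrow> real^3) \<Rightarrow> (complex^3^3) set set" where
  "solution_conics x l = solution_matrices x l // scale_rel"

end

theory Submission
  imports Defs
begin

text \<open>
  In the projective frame whose base points are the three given points, a symmetric matrix through
  these points has zero diagonal, so it is determined by its off-diagonal entries
  \<open>d = (a, b, c)\<close>, and it is non-degenerate iff \<open>a b c \<noteq> 0\<close>.
  Let \<open>p\<close> and \<open>q\<close> be the lines in this frame, \<open>p\<^sub>i = x\<^sub>i \<bullet> l\<^sub>1\<close> and \<open>q\<^sub>i = x\<^sub>i \<bullet> l\<^sub>2\<close>.
  Up to a factor, the condition that \<open>p\<close> is tangent is
  \<open>A\<^sup>2 + B\<^sup>2 + C\<^sup>2 - 2AB - 2AC - 2BC = 0\<close> with \<open>A = p\<^sub>1 a\<close>, \<open>B = p\<^sub>2 b\<close>, \<open>C = p\<^sub>3 c\<close>.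
  This quartic in the square roots is a product of four linear factors: it says that
  \<open>\<surd>A \<plusminus> \<surd>B \<plusminus> \<surd>C = 0\<close> for some choice of signs.

  Write \<open>(a, b, c) = (u\<^sup>2, v\<^sup>2, w\<^sup>2)\<close> and let \<open>\<alpha>\<close>, \<open>\<beta>\<close> be componentwise complex square roots of
  \<open>p\<close>, \<open>q\<close>. The signs of \<open>u, v, w\<close> can be chosen so that \<open>(u, v, w)\<close> is orthogonal to
  \<open>\<alpha>\<close>; then it is also orthogonal to \<open>(\<beta>\<^sub>1, \<plusminus>\<beta>\<^sub>2, \<plusminus>\<beta>\<^sub>3)\<close> for some signs. Hence it is a multiple of
  the cross product of these two vectors, and the four choices of signs give the four conics.
  The hypothesis that the intersection of the lines is on no side says that
  \<open>p\<^sub>i q\<^sub>j \<noteq> p\<^sub>j q\<^sub>i\<close> for \<open>i \<noteq> j\<close>. It makes all components of the cross products nonzero, so that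
  the four conics are non-degenerate. They are also distinct: squaring only forgets signs, and two
  relations between the same nonzero numbers, \<open>X + Y + Z = 0\<close> and \<open>X \<plusminus> Y \<plusminus> Z = 0\<close>, must have the
  same signs.
\<close>

section \<open>Matrices with zero diagonal\<close>

definition hollow :: "complex^3 \<Rightarrow> complex^3^3" where
  "hollow d = vector [vector [0, d$3, d$2], vector [d$3, 0, d$1], vector [d$2, d$1, 0]]"

definition hollow_inv :: "complex^3 \<Rightarrow> complex^3^3" where
  "hollow_inv d = (let e = 2 * d$1 * d$2 * d$3 in
     vector [vector [- ((d$1)^2) / e, d$1 * d$2 / e, d$1 * d$3 / e],
             vector [d$1 * d$2 / e, - ((d$2)^2) / e, d$2 * d$3 / e],
             vector [d$1 * d$3 / e, d$2 * d$3 / e, - ((d$3)^2) / e]])"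

text \<open>The quadratic form of the adjugate of \<open>hollow d\<close> at the line \<open>m\<close>, up to sign.\<close>

definition tangency :: "complex^3 \<Rightarrow> complex^3 \<Rightarrow> complex" where
  "tangency m d = (m$1 * d$1)^2 + (m$2 * d$2)^2 + (m$3 * d$3)^2
     - 2 * (m$1 * d$1 * (m$2 * d$2) + m$1 * d$1 * (m$3 * d$3) + m$2 * d$2 * (m$3 * d$3))"

lemma transpose_hollow: "transpose (hollow d) = hollow d"
  by (simp add: hollow_def transpose_def vec_eq_iff forall_3)

lemma symmetric_zero_diagonal_eq_hollow:
  assumes "transpose D = D" and "\<And>i. D $ i $ i = 0"
  shows "D = hollow (vector [D$2$3, D$1$3, D$1$2])"
proof -
  have sym: "D $ j $ i = D $ i $ j" for i j
    using arg_cong[OF assms(1), of "\<lambda>M. M $ i $ j"] by (simp add: transpose_def)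
  show ?thesis
    using sym[of 2 1] sym[of 3 1] sym[of 3 2]
    by (simp add: hollow_def vec_eq_iff forall_3 assms(2))
qed

lemma det_hollow: "det (hollow d) = 2 * d$1 * d$2 * d$3"
  by (simp add: hollow_def det_3)

lemma hollow_mult_hollow_inv:
  assumes "\<And>i. d $ i \<noteq> 0"
  shows "hollow d ** hollow_inv d = mat 1"
  using assms[of 1] assms[of 2] assms[of 3]
  by (simp add: hollow_def hollow_inv_def Let_def matrix_matrix_mult_def mat_def vec_eq_iff
      forall_3 sum_3 field_simps power2_eq_square)

lemma quad_form_hollow_inv:
  assumes "\<And>i. d $ i \<noteq> 0"
  shows "scalar_product m (hollow_inv d *v m) = - tangency m d / (2 * d$1 * d$2 * d$3)"
  using assms[of 1] assms[of 2] assms[of 3]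
  by (simp add: hollow_inv_def tangency_def Let_def matrix_vector_mult_def scalar_product_def
      sum_3 field_simps power2_eq_square)

lemma hollow_scale: "hollow (k *s d) = map_matrix ((*) k) (hollow d)"
  by (simp add: hollow_def vec_eq_iff forall_3)

lemma hollow_inject: "hollow d = hollow d' \<longleftrightarrow> d = d'"
  by (auto simp: hollow_def vec_eq_iff forall_3)

section \<open>Change of projective frame\<close>

lemma matrix_inv_unique_right:
  fixes A B :: "'a::field^'n^'n"
  assumes "A ** B = mat 1"
  shows "matrix_inv A = B"
proof -
  have "B ** A = mat 1"
    using assms matrix_left_right_inverse by blast
  then have "A ** matrix_inv A = mat 1"
    using assms unfolding matrix_inv_def by (metis (mono_tags, lifting) someI_ex)
  then show ?thesis
    by (metis \<open>B ** A = mat 1\<close> matrix_mul_assoc matrix_mul_lid matrix_mul_rid)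
qed

lemma scalar_product_congruence:
  fixes A B :: "complex^3^3"
  shows "scalar_product v ((transpose A ** B ** A) *v w) = scalar_product (A *v v) (B *v (A *v w))"
  by (simp add: scalar_product_def transpose_def matrix_matrix_mult_def matrix_vector_mult_def
      sum_3 algebra_simps)

definition frame :: "(3 \<Rightarrow> real^3) \<Rightarrow> complex^3^3" where
  "frame x = (\<chi> r i. complex_of_real (x i $ r))"

definition frame_line :: "(3 \<Rightarrow> real^3) \<Rightarrow> real^3 \<Rightarrow> complex^3" where
  "frame_line x m = (\<chi> i. complex_of_real (x i \<bullet> m))"

definition in_frame :: "(3 \<Rightarrow> real^3) \<Rightarrow> complex^3^3 \<Rightarrow> complex^3^3" where
  "in_frame x C = transpose (frame x) ** C ** frame x"

definition conic_of :: "(3 \<Rightarrow> real^3) \<Rightarrow> complex^3 \<Rightarrow> complex^3^3" where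
  "conic_of x d = transpose (matrix_inv (frame x)) ** hollow d ** matrix_inv (frame x)"

lemma det_frame: "det (frame x) = complex_of_real (det (vector [x 1, x 2, x 3] :: real^3^3))"
  by (simp add: frame_def det_3 algebra_simps)

text \<open>A null vector of the matrix whose rows are the points is a line through all of them.\<close>

lemma det_points_nonzero:
  assumes "\<not> collinear_points x"
  shows "det (vector [x 1, x 2, x 3] :: real^3^3) \<noteq> 0"
proof
  assume "det (vector [x 1, x 2, x 3] :: real^3^3) = 0"
  then have "\<not> invertible (vector [x 1, x 2, x 3] :: real^3^3)"
    unfolding invertible_det_nz by blast
  then obtain l :: "real^3" where "l \<noteq> 0" and "(vector [x 1, x 2, x 3] :: real^3^3) *v l = 0"
    unfolding invertible_left_inverse matrix_left_invertible_ker by blast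
  then have "collinear_points x"
    unfolding collinear_points_def lies_on_def
    by (intro exI[of _ l]) (simp add: vec_eq_iff matrix_vector_mult_def forall_3 inner_vec_def)
  with assms show False ..
qed

lemma transpose_frame_mult: "transpose (frame x) *v complex_vec m = frame_line x m"
  by (simp add: frame_def frame_line_def complex_vec_def matrix_vector_mult_def transpose_def
      vec_eq_iff sum_3 inner_vec_def)

lemma in_frame_diagonal: "in_frame x C $ i $ i = quad_form C (x i)"
  by (simp add: in_frame_def quad_form_def frame_def complex_vec_def scalar_product_def
      matrix_matrix_mult_def matrix_vector_mult_def transpose_def sum_3 algebra_simps)

context
  fixes x :: "3 \<Rightarrow> real^3"
  assumes noncollinear: "\<not> collinear_points x"
begin

lemma frame_inverse:
  "frame x ** matrix_inv (frame x) = mat 1" "matrix_inv (frame x) ** frame x = mat 1"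
proof -
  have "det (frame x) \<noteq> 0"
    using det_points_nonzero[OF noncollinear] by (simp add: det_frame)
  then obtain B where B: "frame x ** B = mat 1"
    by (metis invertible_det_nz invertible_right_inverse)
  then have "matrix_inv (frame x) = B" "B ** frame x = mat 1"
    using matrix_inv_unique_right matrix_left_right_inverse by blast+
  with B show "frame x ** matrix_inv (frame x) = mat 1" "matrix_inv (frame x) ** frame x = mat 1"
    by simp_all
qed

lemma frame_inverse_transpose:
  "transpose (frame x) ** transpose (matrix_inv (frame x)) = mat 1"
  "transpose (matrix_inv (frame x)) ** transpose (frame x) = mat 1"
  by (simp_all flip: matrix_transpose_mul add: frame_inverse)

lemma in_frame_conic_of: "in_frame x (conic_of x d) = hollow d"
proof -
  have "in_frame x (conic_of x d)
      = (transpose (frame x) ** transpose (matrix_inv (frame x))) ** hollow d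
        ** (matrix_inv (frame x) ** frame x)"
    by (simp add: in_frame_def conic_of_def matrix_mul_assoc)
  then show ?thesis
    by (simp add: frame_inverse frame_inverse_transpose)
qed

lemma conic_of_in_frame:
  assumes "in_frame x C = hollow d"
  shows "C = conic_of x d"
proof -
  have "conic_of x d
      = (transpose (matrix_inv (frame x)) ** transpose (frame x)) ** C
        ** (frame x ** matrix_inv (frame x))"
    by (simp add: conic_of_def in_frame_def matrix_mul_assoc flip: assms)
  then show ?thesis
    by (simp add: frame_inverse frame_inverse_transpose)
qed

lemma conic_of_inject: "conic_of x d = conic_of x d' \<longleftrightarrow> d = d'"
  by (metis in_frame_conic_of hollow_inject)

lemma conic_of_scale: "conic_of x (k *s d) = map_matrix ((*) k) (conic_of x d)"
  by (simp add: conic_of_def hollow_scale vec_eq_iff matrix_matrix_mult_def sum_3 algebra_simps)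

lemma transpose_conic_of: "transpose (conic_of x d) = conic_of x d"
  by (simp add: conic_of_def matrix_transpose_mul transpose_hollow matrix_mul_assoc)

lemma det_conic_of_nonzero_iff: "det (conic_of x d) \<noteq> 0 \<longleftrightarrow> (\<forall>i. d $ i \<noteq> 0)"
proof -
  have "det (matrix_inv (frame x)) \<noteq> 0"
    by (metis det_I det_mul frame_inverse(1) mult_zero_right zero_neq_one)
  then show ?thesis
    by (simp add: conic_of_def det_mul det_hollow forall_3)
qed

lemma quad_form_conic_of: "quad_form (conic_of x d) (x i) = 0"
proof -
  have "quad_form (conic_of x d) (x i) = hollow d $ i $ i"
    by (metis in_frame_diagonal in_frame_conic_of)
  also have "\<dots> = 0"
    using exhaust_3[of i] by (auto simp: hollow_def)
  finally show ?thesis .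
qed

text \<open>
  Inverting the congruence by the frame turns \<open>C\<inverse>\<close> into a congruence of \<open>hollow_inv d\<close> that acts on
  lines, so tangency can be read off in frame coordinates.
\<close>

lemma quad_form_inv_conic_of_eq_0_iff:
  assumes nz: "\<And>i. d $ i \<noteq> 0"
  shows "quad_form (matrix_inv (conic_of x d)) m = 0 \<longleftrightarrow> tangency (frame_line x m) d = 0"
proof -
  let ?P = "frame x" and ?Q = "matrix_inv (frame x)"
  let ?R = "?P ** hollow_inv d ** transpose ?P"
  have "conic_of x d ** ?R
      = transpose ?Q ** (hollow d ** ((?Q ** ?P) ** hollow_inv d)) ** transpose ?P"
    by (simp add: conic_of_def matrix_mul_assoc)
  also have "\<dots> = mat 1"
    by (simp add: frame_inverse frame_inverse_transpose hollow_mult_hollow_inv[OF nz])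
  finally have "matrix_inv (conic_of x d) = ?R"
    by (rule matrix_inv_unique_right)
  then have "quad_form (matrix_inv (conic_of x d)) m
      = scalar_product (frame_line x m) (hollow_inv d *v frame_line x m)"
    using scalar_product_congruence[of "complex_vec m" "transpose ?P" "hollow_inv d" "complex_vec m"]
    by (simp only: quad_form_def transpose_frame_mult transpose_transpose)
  then show ?thesis
    using nz by (simp add: quad_form_hollow_inv)
qed

text \<open>
  The incidence conditions are used up by the frame: what remains of the problem is two quadratic
  equations for a vector in \<open>\<complex>\<^sup>3\<close> with nonzero components.
\<close>

lemma solution_matrices_eq:
  "solution_matrices x l
     = conic_of x ` {d. (\<forall>i. d $ i \<noteq> 0) \<and> (\<forall>j. tangency (frame_line x (l j)) d = 0)}"
proof (intro set_eqI iffI)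
  fix C assume C: "C \<in> solution_matrices x l"
  let ?D = "in_frame x C"
  have "transpose ?D = ?D"
    using C by (simp add: solution_matrices_def conic_matrix_def in_frame_def
        matrix_transpose_mul matrix_mul_assoc)
  moreover have "?D $ i $ i = 0" for i
    using C by (simp add: in_frame_diagonal solution_matrices_def)
  ultimately obtain d where d: "C = conic_of x d"
    using symmetric_zero_diagonal_eq_hollow conic_of_in_frame by blast
  then have "\<forall>i. d $ i \<noteq> 0"
    using C by (simp add: solution_matrices_def det_conic_of_nonzero_iff)
  with C d show "C \<in> conic_of x `
      {d. (\<forall>i. d $ i \<noteq> 0) \<and> (\<forall>j. tangency (frame_line x (l j)) d = 0)}"
    by (auto simp: solution_matrices_def quad_form_inv_conic_of_eq_0_iff)
next
  fix C assume "C \<in> conic_of x `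
      {d. (\<forall>i. d $ i \<noteq> 0) \<and> (\<forall>j. tangency (frame_line x (l j)) d = 0)}"
  then obtain d where C: "C = conic_of x d" and nz: "\<forall>i. d $ i \<noteq> 0"
    and tang: "\<forall>j. tangency (frame_line x (l j)) d = 0"
    by blast
  have det: "det C \<noteq> 0"
    using nz by (simp add: C det_conic_of_nonzero_iff)
  then have "C \<noteq> 0"
    by (auto simp: det_3)
  with det nz tang show "C \<in> solution_matrices x l"
    by (simp add: C solution_matrices_def conic_matrix_def transpose_conic_of quad_form_conic_of
        quad_form_inv_conic_of_eq_0_iff)
qed

end

text \<open>
  If the cross product of two of the points vanished, so would the determinant of the three.
\<close>

lemma is_side_cross:
  assumes "\<not> collinear_points x" and "i \<noteq> j"
  shows "is_side x (cross3 (x i) (x j))"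
proof -
  have det: "det (vector [x 1, x 2, x 3] :: real^3^3) \<noteq> 0"
    by (rule det_points_nonzero[OF assms(1)])
  have "x 1 \<bullet> cross3 (x 2) (x 3) \<noteq> 0" "x 2 \<bullet> cross3 (x 3) (x 1) \<noteq> 0"
    "x 3 \<bullet> cross3 (x 1) (x 2) \<noteq> 0"
    using det by (simp_all add: dot_cross_det det_3 algebra_simps)
  then have "cross3 (x 1) (x 2) \<noteq> 0" "cross3 (x 3) (x 1) \<noteq> 0" "cross3 (x 2) (x 3) \<noteq> 0"
    by auto
  then have "cross3 (x i) (x j) \<noteq> 0"
    using exhaust_3[of i] exhaust_3[of j] assms(2) cross_skew[of "x i" "x j"] by auto
  then show ?thesis
    unfolding is_side_def lies_on_def using assms(2) by (metis dot_cross_self(1,2))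
qed

section \<open>The two tangency conditions\<close>

text \<open>
  The complex cross product of \<open>\<alpha>\<close> and \<open>(\<beta>\<^sub>1, s \<beta>\<^sub>2, t \<beta>\<^sub>3)\<close>.
\<close>

definition sign_cross :: "complex^3 \<Rightarrow> complex^3 \<Rightarrow> complex \<Rightarrow> complex \<Rightarrow> complex^3" where
  "sign_cross \<alpha> \<beta> s t = vector [t * \<alpha>$2 * \<beta>$3 - s * \<alpha>$3 * \<beta>$2, \<alpha>$3 * \<beta>$1 - t * \<alpha>$1 * \<beta>$3,
     s * \<alpha>$1 * \<beta>$2 - \<alpha>$2 * \<beta>$1]"

definition signs :: "complex set" where
  "signs = {1, -1}"

definition squares :: "complex^3 \<Rightarrow> complex^3" where
  "squares u = (\<chi> i. (u $ i)^2)"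

lemma ex_squares_eq: "\<exists>u. squares u = d"
  by (intro exI[of _ "\<chi> i. csqrt (d $ i)"]) (simp add: squares_def vec_eq_iff)

text \<open>
  Heron's factorization: with \<open>X = \<alpha>\<^sub>1 u\<^sub>1\<close>, \<open>Y = \<alpha>\<^sub>2 u\<^sub>2\<close>, \<open>Z = \<alpha>\<^sub>3 u\<^sub>3\<close>, the left-hand side is
  \<open>X\<^sup>4 + Y\<^sup>4 + Z\<^sup>4 - 2 X\<^sup>2 Y\<^sup>2 - 2 X\<^sup>2 Z\<^sup>2 - 2 Y\<^sup>2 Z\<^sup>2\<close>. It makes the quadratic tangency condition linear
  in the square roots, up to signs.
\<close>

lemma tangency_squares:
  "tangency (squares \<alpha>) (squares u) =
     (\<alpha>$1 * u$1 + \<alpha>$2 * u$2 + \<alpha>$3 * u$3) * (\<alpha>$1 * u$1 - \<alpha>$2 * u$2 - \<alpha>$3 * u$3)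
     * (\<alpha>$1 * u$1 - \<alpha>$2 * u$2 + \<alpha>$3 * u$3) * (\<alpha>$1 * u$1 + \<alpha>$2 * u$2 - \<alpha>$3 * u$3)"
  unfolding tangency_def squares_def by (simp, algebra)

lemma tangency_squares_eq_0_iff:
  "tangency (squares \<alpha>) (squares u) = 0
     \<longleftrightarrow> (\<exists>s\<in>signs. \<exists>t\<in>signs. \<alpha>$1 * u$1 + s * (\<alpha>$2 * u$2) + t * (\<alpha>$3 * u$3) = 0)"
  unfolding tangency_squares signs_def by auto

lemma sign_relation_unique:
  fixes X Y Z :: complex
  assumes "X \<noteq> 0" "Y \<noteq> 0" "Z \<noteq> 0"
    and "r \<in> signs" "s \<in> signs" "t \<in> signs" "r' \<in> signs" "s' \<in> signs" "t' \<in> signs"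
    and "r * X + s * Y + t * Z = 0" "r' * X + s' * Y + t' * Z = 0"
  shows "(r' = r \<and> s' = s \<and> t' = t) \<or> (r' = - r \<and> s' = - s \<and> t' = - t)"
proof (rule ccontr)
  assume no: "\<not> ?thesis"
  \<comment> \<open>The sum and the difference of the relations have coefficients \<open>0\<close> or \<open>\<plusminus>2\<close>, in complementary
     places. So one of them has exactly one nonzero coefficient.\<close>
  have "(r + r') * X + (s + s') * Y + (t + t') * Z = 0"
    and "(r - r') * X + (s - s') * Y + (t - t') * Z = 0"
    using assms(10,11) by algebra+
  with no assms(1-9) show False
    unfolding signs_def by auto
qed

context
  fixes \<alpha> \<beta> :: "complex^3"
  assumes \<alpha>: "\<And>i. \<alpha> $ i \<noteq> 0" and \<beta>: "\<And>i. \<beta> $ i \<noteq> 0"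
    and independent: "\<And>i j. i \<noteq> j \<Longrightarrow> (\<alpha>$i)^2 * (\<beta>$j)^2 \<noteq> (\<alpha>$j)^2 * (\<beta>$i)^2"
begin

text \<open>
  If a component vanished, squaring would remove the signs from the equality of its two terms and
  leave \<open>\<alpha>\<^sub>i\<^sup>2 \<beta>\<^sub>j\<^sup>2 = \<alpha>\<^sub>j\<^sup>2 \<beta>\<^sub>i\<^sup>2\<close>.
\<close>

lemma sign_cross_nonzero:
  assumes "s \<in> signs" "t \<in> signs"
  shows "sign_cross \<alpha> \<beta> s t $ i \<noteq> 0"
proof -
  have sq: "s^2 = 1" "t^2 = 1"
    using assms by (auto simp: signs_def)
  have "t * \<alpha>$2 * \<beta>$3 \<noteq> s * \<alpha>$3 * \<beta>$2"
  proof
    assume "t * \<alpha>$2 * \<beta>$3 = s * \<alpha>$3 * \<beta>$2"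
    then have "(t * \<alpha>$2 * \<beta>$3)^2 = (s * \<alpha>$3 * \<beta>$2)^2" by simp
    then show False
      using independent[of 2 3] by (simp add: power_mult_distrib sq)
  qed
  moreover have "\<alpha>$3 * \<beta>$1 \<noteq> t * \<alpha>$1 * \<beta>$3"
  proof
    assume "\<alpha>$3 * \<beta>$1 = t * \<alpha>$1 * \<beta>$3"
    then have "(\<alpha>$3 * \<beta>$1)^2 = (t * \<alpha>$1 * \<beta>$3)^2" by simp
    then show False
      using independent[of 3 1] by (simp add: power_mult_distrib sq)
  qed
  moreover have "s * \<alpha>$1 * \<beta>$2 \<noteq> \<alpha>$2 * \<beta>$1"
  proof
    assume "s * \<alpha>$1 * \<beta>$2 = \<alpha>$2 * \<beta>$1"
    then have "(s * \<alpha>$1 * \<beta>$2)^2 = (\<alpha>$2 * \<beta>$1)^2" by simp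
    then show False
      using independent[of 1 2] by (simp add: power_mult_distrib sq)
  qed
  ultimately show ?thesis
    using exhaust_3[of i] by (auto simp: sign_cross_def)
qed

lemma sign_cross_orthogonal:
  "\<alpha>$1 * sign_cross \<alpha> \<beta> s t $ 1 + \<alpha>$2 * sign_cross \<alpha> \<beta> s t $ 2 + \<alpha>$3 * sign_cross \<alpha> \<beta> s t $ 3 = 0"
  "\<beta>$1 * sign_cross \<alpha> \<beta> s t $ 1 + s * (\<beta>$2 * sign_cross \<alpha> \<beta> s t $ 2)
     + t * (\<beta>$3 * sign_cross \<alpha> \<beta> s t $ 3) = 0"
  by (simp_all add: sign_cross_def algebra_simps)

lemma tangency_sign_cross:
  assumes "s \<in> signs" "t \<in> signs"
  shows "tangency (squares \<alpha>) (squares (sign_cross \<alpha> \<beta> s t)) = 0"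
    and "tangency (squares \<beta>) (squares (sign_cross \<alpha> \<beta> s t)) = 0"
proof -
  have "(1::complex) \<in> signs"
    by (simp add: signs_def)
  then show "tangency (squares \<alpha>) (squares (sign_cross \<alpha> \<beta> s t)) = 0"
    unfolding tangency_squares_eq_0_iff
    by (intro bexI[of _ 1]) (simp_all add: sign_cross_orthogonal(1))
  show "tangency (squares \<beta>) (squares (sign_cross \<alpha> \<beta> s t)) = 0"
    unfolding tangency_squares_eq_0_iff
    by (intro bexI[of _ s] bexI[of _ t]) (simp_all add: sign_cross_orthogonal(2) assms)
qed

text \<open>
  The signs in the relation with \<open>\<alpha>\<close> are absorbed into the square root \<open>u\<close> of the solution. The
  remaining two signs are those in the relation with \<open>\<beta>\<close>.
\<close>

lemma tangency_imp_sign_cross: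
  assumes nz: "\<And>i. d $ i \<noteq> 0"
    and "tangency (squares \<alpha>) d = 0" and "tangency (squares \<beta>) d = 0"
  shows "\<exists>s\<in>signs. \<exists>t\<in>signs. \<exists>k. k \<noteq> 0 \<and> d = k *s squares (sign_cross \<alpha> \<beta> s t)"
proof -
  obtain u0 where u0: "squares u0 = d"
    using ex_squares_eq by blast
  then obtain s0 t0 where s0: "s0 \<in> signs" and t0: "t0 \<in> signs"
    and rel0: "\<alpha>$1 * u0$1 + s0 * (\<alpha>$2 * u0$2) + t0 * (\<alpha>$3 * u0$3) = 0"
    using assms(2) tangency_squares_eq_0_iff by blast
  define u :: "complex^3" where "u = vector [u0$1, s0 * u0$2, t0 * u0$3]"
  have "s0^2 = 1" "t0^2 = 1"
    using s0 t0 by (auto simp: signs_def)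
  then have u: "d = squares u"
    using u0 by (auto simp: u_def squares_def vec_eq_iff forall_3 power_mult_distrib)
  have rel\<alpha>: "\<alpha>$1 * u$1 + \<alpha>$2 * u$2 + \<alpha>$3 * u$3 = 0"
    using rel0 by (simp add: u_def algebra_simps)
  obtain s t where s: "s \<in> signs" and t: "t \<in> signs"
    and rel\<beta>: "\<beta>$1 * u$1 + s * (\<beta>$2 * u$2) + t * (\<beta>$3 * u$3) = 0"
    using assms(3) tangency_squares_eq_0_iff unfolding u by blast
  define U where "U = sign_cross \<alpha> \<beta> s t"
  have U1: "U$1 \<noteq> 0"
    unfolding U_def by (rule sign_cross_nonzero[OF s t])
  have "u$1 * U$2 = u$2 * U$1" "u$1 * U$3 = u$3 * U$1"
    unfolding U_def sign_cross_def using rel\<alpha> rel\<beta> by (simp_all, algebra+)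
  moreover define k where "k = u$1 / U$1"
  ultimately have uU: "u = k *s U"
    using U1 by (simp add: vec_eq_iff forall_3)
  have "d = k^2 *s squares U"
    unfolding u uU by (simp add: squares_def vec_eq_iff power_mult_distrib)
  moreover have "k^2 \<noteq> 0"
    using nz[of 1] U1 by (simp add: k_def u squares_def)
  ultimately show ?thesis
    using s t unfolding U_def by blast
qed

text \<open>
  Different choices of signs give different conics. Two cross products with proportional squares
  agree up to a factor and the signs of their components. As both are orthogonal to \<open>\<alpha>\<close>, they are
  proportional; so one vector satisfies both relations with \<open>\<beta>\<close>, whose signs must then agree.
\<close>

lemma sign_cross_signs_unique:
  assumes signs: "s \<in> signs" "t \<in> signs" "s' \<in> signs" "t' \<in> signs" and "k \<noteq> 0"
    and eq: "squares (sign_cross \<alpha> \<beta> s' t') = k *s squares (sign_cross \<alpha> \<beta> s t)"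
  shows "s' = s \<and> t' = t"
proof -
  define U where "U = sign_cross \<alpha> \<beta> s t"
  define U' where "U' = sign_cross \<alpha> \<beta> s' t'"
  have nz: "U $ i \<noteq> 0" for i
    unfolding U_def by (rule sign_cross_nonzero[OF signs(1,2)])
  define h where "h = csqrt k"
  have h: "h \<noteq> 0" "h^2 = k"
    using \<open>k \<noteq> 0\<close> by (simp_all add: h_def)
  have "(U' $ i)^2 = (h * U $ i)^2" for i
    using eq h by (simp add: squares_def vec_eq_iff power_mult_distrib U_def U'_def)
  then have "\<exists>\<epsilon>\<in>signs. U' $ i = \<epsilon> * (h * U $ i)" for i
    by (auto simp: power2_eq_iff signs_def)
  then obtain \<epsilon> where \<epsilon>: "\<And>i. \<epsilon> i \<in> signs" and U': "\<And>i. U' $ i = \<epsilon> i * (h * U $ i)"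
    by metis
  have one: "1 \<in> signs"
    by (simp add: signs_def)
  have "h * (\<epsilon> 1 * (\<alpha>$1 * U$1) + \<epsilon> 2 * (\<alpha>$2 * U$2) + \<epsilon> 3 * (\<alpha>$3 * U$3)) = 0"
    using sign_cross_orthogonal(1)[of s' t'] by (simp add: U' algebra_simps flip: U'_def)
  then have "\<epsilon> 1 * (\<alpha>$1 * U$1) + \<epsilon> 2 * (\<alpha>$2 * U$2) + \<epsilon> 3 * (\<alpha>$3 * U$3) = 0"
    using h by simp
  moreover have "1 * (\<alpha>$1 * U$1) + 1 * (\<alpha>$2 * U$2) + 1 * (\<alpha>$3 * U$3) = 0"
    using sign_cross_orthogonal(1)[of s t] by (simp add: U_def)
  \<comment> \<open>Orthogonality to \<open>\<alpha>\<close> forces \<open>U'\<close> to be a multiple of \<open>U\<close>.\<close>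
  ultimately have eqs: "\<epsilon> 2 = \<epsilon> 1" "\<epsilon> 3 = \<epsilon> 1"
    using sign_relation_unique[OF _ _ _ one one one \<epsilon>[of 1] \<epsilon>[of 2] \<epsilon>[of 3],
        of "\<alpha>$1 * U$1" "\<alpha>$2 * U$2" "\<alpha>$3 * U$3"] nz \<alpha> by auto
  have "\<epsilon> 1 \<noteq> 0"
    using \<epsilon>[of 1] by (auto simp: signs_def)
  have "\<epsilon> 1 * h * (1 * (\<beta>$1 * U$1) + s' * (\<beta>$2 * U$2) + t' * (\<beta>$3 * U$3)) = 0"
    using sign_cross_orthogonal(2)[of s' t'] by (simp add: U' eqs algebra_simps flip: U'_def)
  then have "1 * (\<beta>$1 * U$1) + s' * (\<beta>$2 * U$2) + t' * (\<beta>$3 * U$3) = 0"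
    using h \<open>\<epsilon> 1 \<noteq> 0\<close> by simp
  moreover have "1 * (\<beta>$1 * U$1) + s * (\<beta>$2 * U$2) + t * (\<beta>$3 * U$3) = 0"
    using sign_cross_orthogonal(2)[of s t] by (simp add: U_def)
  ultimately show ?thesis
    using sign_relation_unique[OF _ _ _ one signs(1,2) one signs(3,4),
        of "\<beta>$1 * U$1" "\<beta>$2 * U$2" "\<beta>$3 * U$3"] nz \<beta> by auto
qed

end

section \<open>Counting the solutions\<close>

lemma equiv_scale_rel: "equiv UNIV scale_rel"
proof (rule equivI)
  show "refl scale_rel"
    by (rule refl_onI) (auto simp: scale_rel_def vec_eq_iff intro!: exI[of _ 1])
  show "sym scale_rel"
  proof (rule symI)
    fix A B assume "(A, B) \<in> scale_rel"
    then obtain k where "k \<noteq> 0" "B = map_matrix ((*) k) A"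
      by (auto simp: scale_rel_def)
    then show "(B, A) \<in> scale_rel"
      by (auto simp: scale_rel_def vec_eq_iff intro!: exI[of _ "inverse k"])
  qed
  show "trans scale_rel"
  proof (rule transI)
    fix A B C assume "(A, B) \<in> scale_rel" "(B, C) \<in> scale_rel"
    then obtain k k' where "k \<noteq> 0" "B = map_matrix ((*) k) A" "k' \<noteq> 0" "C = map_matrix ((*) k') B"
      by (auto simp: scale_rel_def)
    then show "(A, C) \<in> scale_rel"
      by (auto simp: scale_rel_def vec_eq_iff intro!: exI[of _ "k' * k"])
  qed
qed simp

lemma conic_of_scale_rel_iff:
  assumes "\<not> collinear_points x"
  shows "(conic_of x d, conic_of x d') \<in> scale_rel \<longleftrightarrow> (\<exists>k. k \<noteq> 0 \<and> d' = k *s d)"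
  unfolding scale_rel_def
  by (simp flip: conic_of_scale[OF assms] add: conic_of_inject[OF assms])

theorem theorem4:
  fixes x :: "3 \<Rightarrow> real^3" and l :: "2 \<Rightarrow> real^3"
  assumes finite_points: "\<And>i. x i $ 3 = 1"
    and lines: "\<And>j. l j \<noteq> 0"
    and distinct_lines: "\<not> proj_eq (l 1) (l 2)"
    and general: "general_position x l"
    and not_on_l1: "\<And>i. x i \<bullet> l 1 \<noteq> 0"
    and not_on_l2: "\<And>i. x i \<bullet> l 2 \<noteq> 0"
    and not_on_side: "\<And>s. is_side x s \<Longrightarrow> \<not> lies_on (cross3 (l 1) (l 2)) s"
  shows "card (solution_conics x l) = 4"
proof -
  have nc: "\<not> collinear_points x"
    using general by (simp add: general_position_def)
  obtain \<alpha> \<beta> where \<alpha>: "squares \<alpha> = frame_line x (l 1)" and \<beta>: "squares \<beta> = frame_line x (l 2)"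
    using ex_squares_eq by metis
  have \<alpha>_sq: "(\<alpha> $ i)^2 = complex_of_real (x i \<bullet> l 1)"
    and \<beta>_sq: "(\<beta> $ i)^2 = complex_of_real (x i \<bullet> l 2)" for i
    using \<alpha> \<beta> by (simp_all add: squares_def frame_line_def vec_eq_iff)
  have \<alpha>_nz: "\<alpha> $ i \<noteq> 0" and \<beta>_nz: "\<beta> $ i \<noteq> 0" for i
    using \<alpha>_sq[of i] \<beta>_sq[of i] not_on_l1[of i] not_on_l2[of i] by auto
  have indep: "(\<alpha>$i)^2 * (\<beta>$j)^2 \<noteq> (\<alpha>$j)^2 * (\<beta>$i)^2" if "i \<noteq> j" for i j
  proof -
    have "cross3 (l 1) (l 2) \<bullet> cross3 (x i) (x j) \<noteq> 0"
      using not_on_side[OF is_side_cross[OF nc that]] by (simp add: lies_on_def)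
    then have "(x i \<bullet> l 1) * (x j \<bullet> l 2) \<noteq> (x j \<bullet> l 1) * (x i \<bullet> l 2)"
      by (simp add: dot_cross inner_commute mult.commute)
    then show ?thesis
      unfolding \<alpha>_sq \<beta>_sq by (metis of_real_eq_iff of_real_mult)
  qed
  note facts = \<alpha>_nz \<beta>_nz indep
  define rep where "rep = (\<lambda>(s, t). squares (sign_cross \<alpha> \<beta> s t))"
  define cls where "cls = (\<lambda>d. scale_rel `` {conic_of x d})"
  let ?N = "{d. (\<forall>i. d $ i \<noteq> 0) \<and> (\<forall>j. tangency (frame_line x (l j)) d = 0)}"
  have cls_eq_iff: "cls d = cls d' \<longleftrightarrow> (\<exists>k. k \<noteq> 0 \<and> d' = k *s d)" for d d'
    unfolding cls_def
    by (simp add: eq_equiv_class_iff[OF equiv_scale_rel] conic_of_scale_rel_iff[OF nc])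
  have "solution_conics x l = cls ` ?N"
    by (auto simp: solution_conics_def solution_matrices_eq[OF nc] quotient_def cls_def)
  also have "\<dots> = cls ` rep ` (signs \<times> signs)"
  proof
    show "cls ` ?N \<subseteq> cls ` rep ` (signs \<times> signs)"
    proof (rule image_subsetI)
      fix d assume "d \<in> ?N"
      then have d: "\<And>i. d $ i \<noteq> 0"
        and tang: "tangency (squares \<alpha>) d = 0" "tangency (squares \<beta>) d = 0"
        by (simp_all add: \<alpha> \<beta>)
      obtain s t k where "s \<in> signs" "t \<in> signs" "k \<noteq> 0" "d = k *s rep (s, t)"
        using tangency_imp_sign_cross[OF facts d tang] by (auto simp: rep_def)
      then show "cls d \<in> cls ` rep ` (signs \<times> signs)"
        using cls_eq_iff by (metis SigmaI imageI)
    qed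
    have "rep (s, t) \<in> ?N" if "s \<in> signs" "t \<in> signs" for s t
      using sign_cross_nonzero[OF facts that] tangency_sign_cross[OF facts that]
      by (auto simp: rep_def forall_2 squares_def[of "sign_cross _ _ _ _"] simp flip: \<alpha> \<beta>)
    then show "cls ` rep ` (signs \<times> signs) \<subseteq> cls ` ?N"
      by blast
  qed
  finally have "solution_conics x l = (cls \<circ> rep) ` (signs \<times> signs)"
    by (simp add: image_comp)
  moreover have "inj_on (cls \<circ> rep) (signs \<times> signs)"
  proof (rule inj_onI)
    fix a b assume a: "a \<in> signs \<times> signs" and b: "b \<in> signs \<times> signs"
      and eq: "(cls \<circ> rep) a = (cls \<circ> rep) b"
    obtain s t s' t' where ab: "a = (s, t)" "b = (s', t')"
      and signs: "s \<in> signs" "t \<in> signs" "s' \<in> signs" "t' \<in> signs"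
      using a b by blast
    obtain k where "k \<noteq> 0" "rep b = k *s rep a"
      using eq by (auto simp: cls_eq_iff)
    then have "s' = s \<and> t' = t"
      using sign_cross_signs_unique[OF facts signs] by (simp add: rep_def ab)
    then show "a = b"
      by (simp add: ab)
  qed
  ultimately have "card (solution_conics x l) = card (signs \<times> signs)"
    by (metis card_image)
  also have "\<dots> = 4"
    by (simp add: card_cartesian_product signs_def)
  finally show ?thesis .
qed

end
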